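(* Let $H\in\mathbb{S}^n$, let $A\in\mathbb{R}^{m\times n}$ have full row rank with $m<n$, and let $Z\in\mathbb{R}^{n\times(n-m)}$ have orthonormal columns spanning $\mathcal{N}(A)$. Then $$\lambda_{\min}(Z^{\mathrm T}HZ)=\sup_{\rho\in\mathbb{R}}\lambda_{\min}\bigl(H+\rho A^{\mathrm T}A\bigr).$$
   Context: $\mathbb{S}^n$ denotes the space of $n\times n$ real symmetric matrices, $\mathcal{N}(A)$ the null space of $A$, and $\lambda_{\min}(M)$ the smallest eigenvalue of a symmetric matrix $M$. *)

theory Defs
  imports "HOL-Analysis.Analysis"
begin

definition symmetric_matrix :: "real ^ 'n ^ 'n \<Rightarrow> bool" where
  "symmetric_matrix M \<longleftrightarrow> transpose M = M"

definition null_space :: "real ^ 'n ^ 'm \<Rightarrow> (real ^ 'n) set" where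
  "null_space A = {x. A *v x = 0}"

definition orthonormal_columns :: "real ^ 'k ^ 'n \<Rightarrow> bool" where
  "orthonormal_columns Z \<longleftrightarrow>
     (\<forall>j. norm (column j Z) = 1) \<and>
     (\<forall>i j. i \<noteq> j \<longrightarrow> orthogonal (column i Z) (column j Z))"

definition eigenvalue :: "real ^ 'n ^ 'n \<Rightarrow> real \<Rightarrow> bool" where
  "eigenvalue M \<mu> \<longleftrightarrow> (\<exists>v. v \<noteq> 0 \<and> M *v v = \<mu> *\<^sub>R v)"

text \<open>Only meaningful for symmetric \<open>M\<close>: the set of real eigenvalues is always
  finite, but it may be empty when \<open>M\<close> is not symmetric.\<close>

definition lambda_min :: "real ^ 'n ^ 'n \<Rightarrow> real" where
  "lambda_min M = Min {\<mu>. eigenvalue M \<mu>}"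

end

theory Submission
  imports Defs
begin

text \<open>The smallest eigenvalue of a symmetric matrix is the minimum of its Rayleigh quotient. Testing
  with vectors \<open>Z w\<close>, on which the penalty \<open>\<rho> \<parallel>A x\<parallel>\<^sup>2\<close> vanishes, shows that no \<open>\<rho>\<close> can exceed the
  left-hand side. Conversely, let \<open>c\<close> be smaller than the left-hand side. The unit vectors with
  \<open>x \<bullet> H x \<le> c\<close> form a compact set that misses the null space of \<open>A\<close>, so \<open>\<parallel>A x\<parallel>\<^sup>2\<close> is bounded
  below on it by a positive constant, and a large \<open>\<rho>\<close> lifts the Rayleigh quotient above \<open>c\<close>.\<close>

lemma inner_matrix_vector_commute:
  fixes M :: "real ^ 'n ^ 'n"
  assumes "symmetric_matrix M"
  shows "x \<bullet> (M *v y) = (M *v x) \<bullet> y"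
  using assms dot_lmul_matrix[of x M y] transpose_matrix_vector[of M x]
  by (simp add: symmetric_matrix_def)

text \<open>Eigenvectors for distinct eigenvalues are orthogonal, so choosing one per eigenvalue
  gives an independent, hence finite, set. This makes the \<open>Min\<close> in
  \<open>lambda_min\<close> usable.\<close>

lemma finite_eigenvalues:
  fixes M :: "real ^ 'n ^ 'n"
  assumes "symmetric_matrix M"
  shows "finite {\<mu>. eigenvalue M \<mu>}"
proof -
  let ?E = "{\<mu>. eigenvalue M \<mu>}"
  define f where "f \<mu> = (SOME v. v \<noteq> 0 \<and> M *v v = \<mu> *\<^sub>R v)" for \<mu>
  have f: "f \<mu> \<noteq> 0 \<and> M *v f \<mu> = \<mu> *\<^sub>R f \<mu>" if "\<mu> \<in> ?E" for \<mu>
    using that unfolding f_def eigenvalue_def mem_Collect_eq by (rule someI_ex)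
  have orth: "f \<mu> \<bullet> f \<nu> = 0" if "\<mu> \<in> ?E" "\<nu> \<in> ?E" "\<mu> \<noteq> \<nu>" for \<mu> \<nu>
    using inner_matrix_vector_commute[OF assms, of "f \<mu>" "f \<nu>"] f[OF that(1)] f[OF that(2)] that(3)
    by simp
  have "inj_on f ?E"
    using orth f by (metis inj_onI inner_eq_zero_iff)
  moreover have "finite (f ` ?E)"
  proof (rule independent_imp_finite, rule pairwise_orthogonal_independent)
    show "pairwise orthogonal (f ` ?E)"
      using orth by (auto simp: pairwise_def orthogonal_def)
    show "0 \<notin> f ` ?E"
      using f by force
  qed
  ultimately show ?thesis
    by (rule finite_imageD[rotated])
qed

text \<open>Such a \<open>v\<close> minimises the nonnegative form, so no direction can have a
  nonzero first-order term. Along \<open>y = M *v v\<close> that term is 2t times the squared norm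
  of \<open>y\<close>, which would beat the quadratic term for small negative t.\<close>

lemma psd_inner_zero_imp_kernel:
  fixes M :: "real ^ 'n ^ 'n"
  assumes sym: "symmetric_matrix M"
    and psd: "\<And>x. 0 \<le> x \<bullet> (M *v x)"
    and "v \<bullet> (M *v v) = 0"
  shows "M *v v = 0"
proof (rule ccontr)
  assume "M *v v \<noteq> 0"
  define y where "y = M *v v"
  define a where "a = y \<bullet> y"
  define b where "b = y \<bullet> (M *v y)"
  have a: "a > 0" and b: "b \<ge> 0"
    using \<open>M *v v \<noteq> 0\<close> psd by (auto simp: a_def b_def y_def)
  have expand: "(v + t *\<^sub>R y) \<bullet> (M *v (v + t *\<^sub>R y)) = 2 * t * a + t\<^sup>2 * b" for t
  proof -
    have "v \<bullet> (M *v y) = a"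
      using inner_matrix_vector_commute[OF sym, of v y] by (simp add: a_def y_def)
    moreover have "y \<bullet> (M *v v) = a"
      by (simp add: a_def y_def)
    ultimately show ?thesis
      using assms(3)
      by (simp add: matrix_vector_right_distrib matrix_vector_mult_scaleR inner_add_left
          inner_add_right b_def power2_eq_square algebra_simps)
  qed
  \<comment> \<open>The parabola has its minimum at -a/b; the added 1 covers \<open>b = 0\<close>
    and still leaves a negative value.\<close>
  define t where "t = - a / (b + 1)"
  have "0 \<le> 2 * t * a + t\<^sup>2 * b"
    using psd expand by metis
  also have "2 * t * a + t\<^sup>2 * b = t * a - t\<^sup>2"
  proof -
    have "t * (b + 1) = - a"
      using b by (simp add: t_def)
    then have "t * b = - a - t"
      by (simp add: algebra_simps)
    then show ?thesis
      by (simp add: power2_eq_square mult.assoc right_diff_distrib)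
  qed
  also have "\<dots> < 0"
  proof -
    have "t < 0"
      using a b by (simp add: t_def)
    with a have "t * a < 0"
      by (rule mult_neg_pos[rotated])
    then show ?thesis
      using zero_le_power2[of t] by linarith
  qed
  finally show False by simp
qed

text \<open>Compactness of the unit sphere gives a minimiser \<open>v\<close> of the form, with
  value \<mu>. Then M - \<mu> I is positive semidefinite and its form vanishes at \<open>v\<close>,
  so \<open>v\<close> lies in its kernel and \<mu> is an eigenvalue. Testing the lower bound with
  any other eigenvector shows that \<mu> is the smallest. No spectral decomposition is
  needed.\<close>

lemma Rayleigh_minimum:
  fixes M :: "real ^ 'n ^ 'n"
  assumes sym: "symmetric_matrix M"
  obtains v where "norm v = 1" "v \<bullet> (M *v v) = lambda_min M"
    and "\<And>x. lambda_min M * (norm x)\<^sup>2 \<le> x \<bullet> (M *v x)"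
proof -
  let ?S = "sphere (0 :: real ^ 'n) 1"
  have "?S \<noteq> {}"
    by simp
  moreover have "continuous_on ?S (\<lambda>x. x \<bullet> (M *v x))"
    by (intro continuous_intros)
  ultimately obtain v where v: "v \<in> ?S" and vmin: "\<And>x. x \<in> ?S \<Longrightarrow> v \<bullet> (M *v v) \<le> x \<bullet> (M *v x)"
    using continuous_attains_inf[OF compact_sphere, of 0 1 "\<lambda>x. x \<bullet> (M *v x)"] by blast
  define \<mu> where "\<mu> = v \<bullet> (M *v v)"
  have nv: "norm v = 1"
    using v by simp
  have lower: "\<mu> * (norm x)\<^sup>2 \<le> x \<bullet> (M *v x)" for x
  proof (cases "x = 0")
    case False
    then have "\<mu> \<le> (x /\<^sub>R norm x) \<bullet> (M *v (x /\<^sub>R norm x))"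
      unfolding \<mu>_def by (intro vmin) simp
    also have "\<dots> = (x \<bullet> (M *v x)) / (norm x)\<^sup>2"
      by (simp add: matrix_vector_mult_scaleR divide_simps power2_eq_square)
    finally show ?thesis
      using False by (simp add: field_simps)
  qed simp
  have "\<mu> = lambda_min M"
  proof -
    let ?N = "M - \<mu> *\<^sub>R mat 1"
    have N: "?N *v x = M *v x - \<mu> *\<^sub>R x" for x
      by (simp add: matrix_vector_mult_diff_rdistrib scaleR_matrix_vector_assoc[symmetric])
    have "symmetric_matrix ?N"
      using sym unfolding symmetric_matrix_def
      by (simp add: transpose_def vec_eq_iff mat_def)
    then have "?N *v v = 0"
    proof (rule psd_inner_zero_imp_kernel)
      show "0 \<le> x \<bullet> (?N *v x)" for x
        using lower[of x] unfolding N by (simp add: inner_diff_right dot_square_norm)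
      show "v \<bullet> (?N *v v) = 0"
        using nv unfolding N by (simp add: inner_diff_right dot_square_norm flip: \<mu>_def)
    qed
    then have "M *v v = \<mu> *\<^sub>R v"
      by (simp add: N)
    moreover have "v \<noteq> 0"
      using nv by auto
    ultimately have "eigenvalue M \<mu>"
      unfolding eigenvalue_def by blast
    moreover have "\<mu> \<le> \<nu>" if eig: "eigenvalue M \<nu>" for \<nu>
    proof -
      obtain w where "w \<noteq> 0" "M *v w = \<nu> *\<^sub>R w"
        using eig by (auto simp: eigenvalue_def)
      with lower[of w] show ?thesis
        by (simp add: dot_square_norm)
    qed
    ultimately show ?thesis
      unfolding lambda_min_def using finite_eigenvalues[OF sym]
      by (intro Min_eqI[symmetric]) auto
  qed
  then show thesis
    using nv lower by (intro that[of v]) (simp_all add: \<mu>_def)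
qed

lemma lambda_min_le_Rayleigh:
  fixes M :: "real ^ 'n ^ 'n"
  assumes "symmetric_matrix M"
  shows "lambda_min M * (norm x)\<^sup>2 \<le> x \<bullet> (M *v x)"
  using Rayleigh_minimum[OF assms] by metis

text \<open>Besides handling the reduced matrix, the instance \<open>H = mat 1\<close> yields the
  norm identities for both \<open>A\<close> and \<open>Z\<close>.\<close>

lemma inner_congruence:
  fixes H :: "real ^ 'n ^ 'n" and Z :: "real ^ 'k ^ 'n"
  shows "w \<bullet> ((transpose Z ** H ** Z) *v w) = (Z *v w) \<bullet> (H *v (Z *v w))"
proof -
  have "w \<bullet> (transpose Z *v y) = (Z *v w) \<bullet> y" for y
    using dot_lmul_matrix[of w "transpose Z" y] by (simp only: vector_transpose_matrix)
  then show ?thesis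
    by (simp only: matrix_vector_mul_assoc[symmetric])
qed

lemma inner_penalized:
  fixes H :: "real ^ 'n ^ 'n" and A :: "real ^ 'n ^ 'm"
  shows "x \<bullet> ((H + \<rho> *\<^sub>R (transpose A ** A)) *v x) = x \<bullet> (H *v x) + \<rho> * (norm (A *v x))\<^sup>2"
proof -
  have "x \<bullet> ((transpose A ** A) *v x) = (norm (A *v x))\<^sup>2"
    using inner_congruence[of x A "mat 1"] by (simp add: dot_square_norm)
  then show ?thesis
    by (simp add: matrix_vector_mult_add_rdistrib inner_add_right scaleR_matrix_vector_assoc[symmetric])
qed

lemma symmetric_matrix_congruence:
  assumes "symmetric_matrix H"
  shows "symmetric_matrix (transpose Z ** H ** Z)"
  using assms by (simp add: symmetric_matrix_def matrix_transpose_mul matrix_mul_assoc)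

lemma symmetric_matrix_penalized:
  assumes "symmetric_matrix H"
  shows "symmetric_matrix (H + \<rho> *\<^sub>R (transpose A ** A))"
proof -
  have "symmetric_matrix (transpose A ** A)"
    by (simp add: symmetric_matrix_def matrix_transpose_mul)
  with assms show ?thesis
    by (simp add: symmetric_matrix_def transpose_def vec_eq_iff)
qed

lemma norm_orthonormal_columns:
  fixes Z :: "real ^ 'k ^ 'n"
  assumes "orthonormal_columns Z"
  shows "norm (Z *v w) = norm w"
proof -
  have "transpose Z ** Z = mat 1"
    using assms
    unfolding matrix_mult_transpose_dot_column
    by (simp add: orthonormal_columns_def orthogonal_def norm_eq_1 vec_eq_iff mat_def)
  then have "(Z *v w) \<bullet> (Z *v w) = w \<bullet> w"
    using inner_congruence[of w Z "mat 1"] by simp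
  then show ?thesis
    by (simp add: norm_eq)
qed

text \<open>One direction of Finsler's lemma, normalised to unit vectors. The weak inequality in the
  conclusion suffices, since \<open>c\<close> may later be taken arbitrarily close to the left-hand
  side from below.\<close>

lemma Finsler:
  fixes H :: "real ^ 'n ^ 'n" and A :: "real ^ 'n ^ 'm"
  assumes pos: "\<And>x. norm x = 1 \<Longrightarrow> A *v x = 0 \<Longrightarrow> c < x \<bullet> (H *v x)"
  obtains \<rho> where "\<And>x. norm x = 1 \<Longrightarrow> c \<le> x \<bullet> (H *v x) + \<rho> * (norm (A *v x))\<^sup>2"
proof -
  let ?S = "sphere (0 :: real ^ 'n) 1"
  let ?q = "\<lambda>x. x \<bullet> (H *v x)"
  let ?K = "?S \<inter> {x. ?q x \<le> c}"
  have "closed {x. ?q x \<le> c}"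
    by (intro closed_Collect_le continuous_intros)
  then have K: "compact ?K"
    by (intro compact_Int_closed compact_sphere)
  show thesis
  proof (cases "?K = {}")
    case True
    then have "c \<le> ?q x + 0 * (norm (A *v x))\<^sup>2" if "norm x = 1" for x
      using that by (force simp: not_le)
    then show thesis
      by (rule that)
  next
    case False
    have "continuous_on ?K (\<lambda>x. (norm (A *v x))\<^sup>2)" "continuous_on ?K ?q"
      by (intro continuous_intros)+
    then obtain a b where a: "a \<in> ?K" "\<And>x. x \<in> ?K \<Longrightarrow> (norm (A *v a))\<^sup>2 \<le> (norm (A *v x))\<^sup>2"
      and b: "b \<in> ?K" "\<And>x. x \<in> ?K \<Longrightarrow> ?q b \<le> ?q x"
      using continuous_attains_inf[OF K False, of ?q]
        continuous_attains_inf[OF K False, of "\<lambda>x. (norm (A *v x))\<^sup>2"] by blast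
    define m where "m = (norm (A *v a))\<^sup>2"
    \<comment> \<open>On \<open>?K\<close> the form is at least \<open>?q b\<close> and the squared
      norm of \<open>A *v x\<close> is at least \<open>m\<close>, so this penalty covers the worst
      deficit \<open>c - ?q b\<close>. Outside \<open>?K\<close> the form already exceeds
      \<open>c\<close>, and a nonnegative penalty does no harm.\<close>
    define \<rho> where "\<rho> = (c - ?q b) / m"
    have "m > 0"
      using a(1) pos[of a] by (force simp: m_def)
    have "\<rho> \<ge> 0"
      using b(1) \<open>m > 0\<close> by (simp add: \<rho>_def)
    have "c \<le> ?q x + \<rho> * (norm (A *v x))\<^sup>2" if "norm x = 1" for x
    proof (cases "?q x \<le> c")
      case True
      with that have "x \<in> ?K"
        by simp
      then have "\<rho> * m \<le> \<rho> * (norm (A *v x))\<^sup>2" "?q b \<le> ?q x"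
        using a(2) b(2) \<open>\<rho> \<ge> 0\<close> by (auto simp: m_def intro: mult_left_mono)
      moreover have "\<rho> * m = c - ?q b"
        using \<open>m > 0\<close> by (simp add: \<rho>_def)
      ultimately show ?thesis
        by linarith
    next
      case False
      moreover have "0 \<le> \<rho> * (norm (A *v x))\<^sup>2"
        using \<open>\<rho> \<ge> 0\<close> by simp
      ultimately show ?thesis
        by linarith
    qed
    then show thesis
      by (rule that)
  qed
qed

theorem theorem2p1:
  fixes H :: "real ^ 'n ^ 'n" and A :: "real ^ 'n ^ 'm" and Z :: "real ^ 'k ^ 'n"
  assumes "symmetric_matrix H"
    and "rank A = CARD('m)"
    and "CARD('m) < CARD('n)"
    and "CARD('k) = CARD('n) - CARD('m)"
    and "orthonormal_columns Z"
    and "span (columns Z) = null_space A"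
  shows "ereal (lambda_min (transpose Z ** H ** Z)) =
    (SUP \<rho>::real. ereal (lambda_min (H + \<rho> *\<^sub>R (transpose A ** A))))"
proof (rule antisym)
  let ?R = "transpose Z ** H ** Z"
  let ?P = "\<lambda>\<rho>. H + \<rho> *\<^sub>R (transpose A ** A)"
  have symR: "symmetric_matrix ?R" and symP: "symmetric_matrix (?P \<rho>)" for \<rho>
    using assms(1) by (rule symmetric_matrix_congruence symmetric_matrix_penalized)+
  have kernel: "A *v x = 0 \<longleftrightarrow> (\<exists>w. x = Z *v w)" for x
  proof -
    have "column j Z \<in> range ((*v) Z)" for j
      using matrix_vector_mult_basis[of Z j] by (metis rangeI)
    then have "span (columns Z) \<subseteq> range ((*v) Z)"
      by (intro span_minimal linear_subspace_image) (auto simp: columns_def)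
    moreover have "range ((*v) Z) \<subseteq> span (columns Z)"
      using matrix_vector_mult_in_columnspace by blast
    ultimately have "span (columns Z) = range ((*v) Z)"
      by (rule antisym)
    then show ?thesis
      using assms(6) by (auto simp: null_space_def)
  qed
  note norm_Z = norm_orthonormal_columns[OF assms(5)]
  show "(SUP \<rho>. ereal (lambda_min (?P \<rho>))) \<le> ereal (lambda_min ?R)"
  proof (rule SUP_least)
    fix \<rho>
    \<comment> \<open>The image \<open>Z *v w\<close> of this minimiser is a unit vector in the null
      space, so it serves as one test vector for every \<rho>.\<close>
    obtain w where w: "norm w = 1" "w \<bullet> (?R *v w) = lambda_min ?R"
      using Rayleigh_minimum[OF symR] by metis
    have "A *v (Z *v w) = 0"
      using kernel by blast
    then have "lambda_min (?P \<rho>) \<le> lambda_min ?R"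
      using lambda_min_le_Rayleigh[OF symP, of \<rho> "Z *v w"] w norm_Z[of w]
      by (simp add: inner_penalized inner_congruence)
    then show "ereal (lambda_min (?P \<rho>)) \<le> ereal (lambda_min ?R)"
      by simp
  qed
  show "ereal (lambda_min ?R) \<le> (SUP \<rho>. ereal (lambda_min (?P \<rho>)))"
    unfolding le_SUP_iff
  proof (intro allI impI)
    fix y
    assume "y < ereal (lambda_min ?R)"
    \<comment> \<open>The bound \<open>y\<close> may be minus infinity; a real \<open>c\<close>
      strictly in between also supplies the strictness that \<open>Finsler\<close> requires.\<close>
    then obtain c where c: "y < ereal c" "c < lambda_min ?R"
      using ereal_dense2 by force
    have "c < x \<bullet> (H *v x)" if x: "norm x = 1" "A *v x = 0" for x
    proof -
      obtain w where "x = Z *v w"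
        using x(2) kernel by blast
      then show ?thesis
        using lambda_min_le_Rayleigh[OF symR, of w] c(2) x(1) norm_Z[of w]
        by (simp add: inner_congruence)
    qed
    then obtain \<rho> where \<rho>: "\<And>x. norm x = 1 \<Longrightarrow> c \<le> x \<bullet> (H *v x) + \<rho> * (norm (A *v x))\<^sup>2"
      using Finsler by blast
    have "c \<le> lambda_min (?P \<rho>)"
      \<comment> \<open>The smallest eigenvalue is attained at a unit vector, to which the bound for
        \<rho> applies.\<close>
      by (rule Rayleigh_minimum[OF symP[of \<rho>]]) (metis \<rho> inner_penalized)
    then show "\<exists>\<rho>\<in>UNIV. y < ereal (lambda_min (?P \<rho>))"
      using c(1) by (meson UNIV_I ereal_less_eq(3) less_le_trans)
  qed
qed

end
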